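(* Let $n\ge2$ be a natural number and let $\mathbb F_2$ be the free group on generators $\sigma,\tau$. Define $\gamma_0:=\sigma^{n-1}$, $\gamma_1:=\tau\sigma^{n-2}$, and $\gamma_i:=\sigma^{-i+1}\tau\sigma^{i-2}$ for $2\le i<n$. Then for each $\omega\in\mathbb F_2$ there is a partition $\mathbb F_2=A_0\sqcup B_0\sqcup\dots\sqcup A_{n-1}\sqcup B_{n-1}$ of $\mathbb F_2$ into $2n$ subsets such that the identity $\varepsilon$ and $\omega$ belong to the same element of the partition, and such that $\gamma_i(B_i)=\mathbb F_2-A_i$ for all $i<n$.
   Context: For $\gamma\in\mathbb F_2$ and $E\subseteq\mathbb F_2$, $\gamma(E):=\{\gamma\beta:\beta\in E\}$ (left multiplication). $\varepsilon$ denotes the empty word (identity). *)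

theory Defs
  imports "HOL-Algebra.Coset" "HOL-Library.Disjoint_Sets"
begin

text \<open>
  The free group over the generator type \<open>'g\<close>, realised on reduced words. The letter
  \<open>(x, True)\<close> stands for the generator \<open>x\<close> and \<open>(x, False)\<close> for its inverse.
\<close>

type_synonym 'g word = "('g \<times> bool) list"

definition inv_letter :: "'g \<times> bool \<Rightarrow> 'g \<times> bool" where
  "inv_letter a = (fst a, \<not> snd a)"

definition reduced :: "'g word \<Rightarrow> bool" where
  "reduced w \<longleftrightarrow> successively (\<lambda>a b. b \<noteq> inv_letter a) w"

text \<open>Left multiplication of a reduced word by one letter, cancelling if possible.\<close>

fun push :: "'g \<times> bool \<Rightarrow> 'g word \<Rightarrow> 'g word" where
  "push a [] = [a]"
| "push a (b # w) = (if b = inv_letter a then w else a # b # w)"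

definition free_group :: "'g word monoid" where
  "free_group = \<lparr>carrier = {w. reduced w}, mult = foldr push, one = []\<rparr>"

definition free_gen :: "'g \<Rightarrow> 'g word" where
  "free_gen x = [(x, True)]"

datatype gen2 = Sigma_gen | Tau_gen

abbreviation F2 :: "gen2 word monoid" where
  "F2 \<equiv> free_group"

definition \<sigma> :: "gen2 word" where "\<sigma> = free_gen Sigma_gen"
definition \<tau> :: "gen2 word" where "\<tau> = free_gen Tau_gen"

definition \<gamma> :: "nat \<Rightarrow> nat \<Rightarrow> gen2 word" where
  "\<gamma> n i =
    (if i = 0 then \<sigma> [^]\<^bsub>F2\<^esub> (int n - 1)
     else if i = 1 then \<tau> \<otimes>\<^bsub>F2\<^esub> \<sigma> [^]\<^bsub>F2\<^esub> (int n - 2)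
     else \<sigma> [^]\<^bsub>F2\<^esub> (- int i + 1) \<otimes>\<^bsub>F2\<^esub> \<tau> \<otimes>\<^bsub>F2\<^esub> \<sigma> [^]\<^bsub>F2\<^esub> (int i - 2))"

text \<open>The construction is a group and has the universal property of the free group.\<close>

lemma inv_letter_inv_letter [simp]: "inv_letter (inv_letter a) = a"
  by (simp add: inv_letter_def)

lemma inv_letter_neq [simp]: "inv_letter a \<noteq> a"
  by (cases a) (simp add: inv_letter_def)

lemma reduced_Nil [simp]: "reduced []"
  by (simp add: reduced_def)

lemma reduced_Cons: "reduced (a # w) \<longleftrightarrow> (w = [] \<or> hd w \<noteq> inv_letter a) \<and> reduced w"
  by (auto simp: reduced_def successively_Cons)

lemma reduced_push: "reduced w \<Longrightarrow> reduced (push a w)"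
  by (cases w) (auto simp: reduced_Cons)

lemma push_reduced_Cons: "reduced (a # w) \<Longrightarrow> push a w = a # w"
  by (cases w) (auto simp: reduced_Cons)

lemma push_push_inv: "reduced w \<Longrightarrow> push a (push (inv_letter a) w) = w"
  by (cases w) (auto simp: reduced_Cons push_reduced_Cons)

lemma reduced_foldr_push: "reduced v \<Longrightarrow> reduced (foldr push w v)"
  by (induction w) (auto intro: reduced_push)

lemma foldr_push_push:
  assumes "reduced v"
  shows "foldr push (push a w) v = push a (foldr push w v)"
proof (cases w)
  case (Cons b w')
  then show ?thesis
    using push_push_inv[OF reduced_foldr_push[OF assms], of a w'] by simp
qed simp

lemma foldr_push_assoc:
  "reduced v \<Longrightarrow> foldr push (foldr push u w) v = foldr push u (foldr push w v)"
  by (induction u) (simp_all add: foldr_push_push)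

lemma foldr_push_Nil: "reduced w \<Longrightarrow> foldr push w [] = w"
  by (induction w) (auto simp: push_reduced_Cons reduced_Cons)

lemma foldr_push_inverse:
  "\<exists>v. reduced v \<and> foldr push v w = []" if "reduced w" for w :: "'g word"
  using that
proof (induction w)
  case Nil
  show ?case by (rule exI[of _ "[]"]) simp
next
  case (Cons a w)
  then obtain v where v: "reduced v" "foldr push v w = []"
    by (auto simp: reduced_Cons)
  have red: "reduced [inv_letter a]" "reduced w"
    using Cons.prems by (auto simp: reduced_Cons)
  let ?u = "foldr push v [inv_letter a]"
  have "foldr push ?u (a # w) = foldr push v (foldr push [inv_letter a] (a # w))"
    by (rule foldr_push_assoc[OF Cons.prems])
  also have "\<dots> = []" using v by simp
  finally show ?case using reduced_foldr_push[OF red(1)] by blast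
qed

lemma group_free_group: "group free_group"
  by (rule groupI)
    (auto simp: free_group_def reduced_foldr_push foldr_push_assoc dest: foldr_push_inverse)

lemma free_gen_closed: "free_gen x \<in> carrier free_group"
  by (simp add: free_group_def free_gen_def reduced_Cons)

lemma inv_free_gen: "inv\<^bsub>free_group\<^esub> (free_gen x) = [(x, False)]"
  by (rule group.inv_equality[OF group_free_group])
    (auto simp: free_group_def free_gen_def reduced_Cons inv_letter_def)

theorem free_group_universal:
  fixes H :: "('h, 'c) monoid_scheme" and f :: "'g \<Rightarrow> 'h"
  assumes "group H" and f: "\<And>x. f x \<in> carrier H"
  shows "\<exists>h \<in> hom free_group H. (\<forall>x. h (free_gen x) = f x) \<and>
    (\<forall>h' \<in> hom free_group H. (\<forall>x. h' (free_gen x) = f x) \<longrightarrow>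
      (\<forall>w \<in> carrier free_group. h' w = h w))"
proof -
  interpret H: group H by fact
  interpret F: group "free_group :: 'g word monoid" by (rule group_free_group)
  define l where "l a = (if snd a then f (fst a) else inv\<^bsub>H\<^esub> f (fst a))" for a
  define h where "h w = foldr (\<lambda>a y. l a \<otimes>\<^bsub>H\<^esub> y) w \<one>\<^bsub>H\<^esub>" for w
  have lc [simp]: "l a \<in> carrier H" for a by (simp add: l_def f)
  have hNil [simp]: "h [] = \<one>\<^bsub>H\<^esub>" and hCons [simp]: "h (a # w) = l a \<otimes>\<^bsub>H\<^esub> h w" for a w
    by (simp_all add: h_def)
  have hc [simp]: "h w \<in> carrier H" for w by (induction w) auto
  have linv: "l a \<otimes>\<^bsub>H\<^esub> l (inv_letter a) = \<one>\<^bsub>H\<^esub>" for a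
    by (simp add: l_def inv_letter_def f)
  have hpush: "h (push a w) = l a \<otimes>\<^bsub>H\<^esub> h w" for a w
    by (cases w) (auto simp: H.m_assoc[symmetric] linv)
  have hmult: "h (foldr push u w) = h u \<otimes>\<^bsub>H\<^esub> h w" for u w
    by (induction u) (auto simp: hpush H.m_assoc)
  have hom: "h \<in> hom free_group H"
    by (auto simp: hom_def free_group_def hmult)
  have gens: "h (free_gen x) = f x" for x
    by (simp add: free_gen_def l_def f)
  have uniq: "h' w = h w"
    if h': "h' \<in> hom free_group H" "\<And>x. h' (free_gen x) = f x"
      and w: "w \<in> carrier free_group" for h' w
  proof -
    interpret h': group_hom free_group H h'
      by unfold_locales (rule h'(1))
    have letter: "h' [a] = l a" for a
    proof (cases a)
      case (Pair x b)
      show ?thesis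
      proof (cases b)
        case True
        then show ?thesis using h'(2)[of x] Pair by (simp add: free_gen_def l_def)
      next
        case False
        then show ?thesis
          using h'.hom_inv[OF free_gen_closed, of x] h'(2)[of x] Pair
          by (simp add: inv_free_gen l_def)
      qed
    qed
    from w show ?thesis
    proof (induction w)
      case Nil
      show ?case using h'.hom_one by (simp add: free_group_def)
    next
      case (Cons a w)
      then have red: "reduced (a # w)" "reduced w" "reduced [a]"
        by (auto simp: free_group_def reduced_Cons)
      have "h' (a # w) = h' ([a] \<otimes>\<^bsub>free_group\<^esub> w)"
        using push_reduced_Cons[OF red(1)] by (simp add: free_group_def)
      also have "\<dots> = h' [a] \<otimes>\<^bsub>H\<^esub> h' w"
        by (rule h'.hom_mult) (use red in \<open>simp_all add: free_group_def\<close>)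
      also have "\<dots> = h (a # w)"
        using Cons.IH red(2) by (simp add: letter free_group_def)
      finally show ?case .
    qed
  qed
  show ?thesis using hom gens uniq by blast
qed

end

theory Submission
  imports Defs
begin

text \<open>
  Call the vertices \<open>x, \<sigma> x, \<dots>, \<sigma>^(n-2) x\<close> of the Cayley tree of \<open>F2\<close> (edges given by left
  multiplication with generators) the block of \<open>x\<close>. The element \<open>\<gamma> n i\<close> carries \<open>x\<close> to a point whose
  block is joined to that of \<open>x\<close> by a single edge, and the \<open>2n\<close> edges leaving a block arise in this
  way from the \<open>\<gamma> n i\<close> and their inverses. Fix an end of the tree, let every vertex select its edge
  towards the end; as the \<open>n-2\<close> inner edges of a block are selected by vertices of the block, exactly
  one of its \<open>n-1\<close> vertices selects an edge leaving it. Sort the points \<open>x\<close> by the edge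
  through which the block of \<open>x\<close> is left in the direction of the end. Every edge is selected by exactly one of its two vertices, which is the
  condition \<open>\<gamma>\<^sub>i B\<^sub>i = F2 - A\<^sub>i\<close>. For \<open>\<epsilon>\<close> and \<open>\<omega>\<close> to lie in the same piece, take the edge \<open>e\<close> through
  which one leaves the block of \<open>\<omega>\<close> in the direction of \<open>\<epsilon>\<close>, and choose an end that is reached from
  the block of \<open>\<epsilon>\<close> through the corresponding edge and from the block of \<open>\<omega>\<close> through \<open>e\<close>.
\<close>

subsection \<open>Ends of the Cayley tree\<close>

text \<open>An end is given by the ray \<open>[], [s 0], [s 1, s 0], \<dots>\<close>: a step along an edge multiplies from the left.\<close>

definition ray :: "(nat \<Rightarrow> 'g \<times> bool) \<Rightarrow> nat \<Rightarrow> 'g word" where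
  "ray s i = rev (map s [0..<i])"

definition nonbacktracking :: "(nat \<Rightarrow> 'g \<times> bool) \<Rightarrow> bool" where
  "nonbacktracking s \<longleftrightarrow> (\<forall>i. s (Suc i) \<noteq> inv_letter (s i))"

text \<open>The ray starts at the root \<open>[]\<close>, so from a vertex off the ray the path to
  the end first goes back towards the root, by cancelling the head.\<close>

definition toward :: "(nat \<Rightarrow> 'g \<times> bool) \<Rightarrow> 'g word \<Rightarrow> 'g \<times> bool" where
  "toward s x = (if x = ray s (length x) then s (length x) else inv_letter (hd x))"

lemma ray_0 [simp]: "ray s 0 = []"
  by (simp add: ray_def)

lemma ray_Suc [simp]: "ray s (Suc i) = s i # ray s i"
  by (simp add: ray_def)

lemma length_ray [simp]: "length (ray s i) = i"
  by (simp add: ray_def)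

lemma toward_ray [simp]: "toward s (ray s i) = s i"
  by (simp add: toward_def)

lemma inv_letter_eq_iff: "inv_letter a = b \<longleftrightarrow> a = inv_letter b"
  by (metis inv_letter_inv_letter)

lemma toward_Cons:
  assumes s: "nonbacktracking s" and red: "reduced (c # x)"
  shows "toward s (c # x) = inv_letter c \<longleftrightarrow> toward s x \<noteq> c"
proof (cases "x = ray s (length x)")
  case True
  then show ?thesis
    using s by (auto simp: toward_def nonbacktracking_def)
next
  case False
  then have "x \<noteq> []" by auto
  with False red show ?thesis
    by (auto simp: toward_def reduced_Cons inv_letter_eq_iff)
qed

text \<open>If \<open>c\<close> cancels, this is \<open>toward_Cons\<close> for the same edge, read
  from its other end point.\<close>

lemma toward_push:
  assumes s: "nonbacktracking s" and red: "reduced x"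
  shows "toward s (push c x) = inv_letter c \<longleftrightarrow> toward s x \<noteq> c"
proof (cases "reduced (c # x)")
  case True
  then show ?thesis
    using toward_Cons[OF s True] by (simp add: push_reduced_Cons)
next
  case False
  with red obtain x' where x: "x = inv_letter c # x'"
    by (cases x) (auto simp: reduced_Cons)
  show ?thesis
    using toward_Cons[OF s red[unfolded x]] by (auto simp: x)
qed

text \<open>Once a label differs from \<open>u\<close>, all later ones are \<open>v\<close>. The
  only possible \<open>k\<close> is thus the first index whose label is not \<open>u\<close>, capped
  at \<open>m\<close>.\<close>

lemma unique_exit:
  fixes l :: "nat \<Rightarrow> 'l"
  assumes "u \<noteq> v" and step: "\<And>k. l (Suc k) = v \<longleftrightarrow> l k \<noteq> u"
  shows "\<exists>!k. k \<le> m \<and> (l k = u \<longrightarrow> k = m) \<and> (l k = v \<longrightarrow> k = 0)"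
proof -
  define k where "k = (LEAST k. k = m \<or> l k \<noteq> u)"
  have k: "k = m \<or> l k \<noteq> u" unfolding k_def by (rule LeastI[of _ m]) simp
  have "k \<le> m" unfolding k_def by (rule Least_le) simp
  have bottom: "k = 0" if "l k = v"
  proof (rule ccontr)
    assume "k \<noteq> 0"
    then obtain j where j: "k = Suc j" by (cases k) auto
    then have "l j = u" using not_less_Least[of j "\<lambda>k. k = m \<or> l k \<noteq> u"] by (simp add: k_def)
    with that j step show False by blast
  qed
  have order: "\<not> i < j"
    if i: "l i = u \<longrightarrow> i = m" and j: "j \<le> m" "l j = v \<longrightarrow> j = 0" for i j
  proof
    assume less: "i < j"
    have "l (Suc i + d) = v" for d
    proof (induction d)
      case 0
      have "l i \<noteq> u" using i less j by auto
      then show ?case using step by simp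
    next
      case (Suc d)
      then show ?case using step[of "Suc i + d"] \<open>u \<noteq> v\<close> by simp
    qed
    from this[of "j - Suc i"] less j show False by simp
  qed
  have first: "k \<le> m \<and> (l k = u \<longrightarrow> k = m) \<and> (l k = v \<longrightarrow> k = 0)"
    using k \<open>k \<le> m\<close> bottom by auto
  then show ?thesis
  proof (rule ex1I)
    fix j assume "j \<le> m \<and> (l j = u \<longrightarrow> j = m) \<and> (l j = v \<longrightarrow> j = 0)"
    with first have "\<not> k < j" "\<not> j < k" by (simp_all add: order)
    then show "j = k" by simp
  qed
qed

subsection \<open>Pieces\<close>

abbreviation "S \<equiv> (Sigma_gen, True)"
abbreviation "S' \<equiv> (Sigma_gen, False)"
abbreviation "T \<equiv> (Tau_gen, True)"
abbreviation "T' \<equiv> (Tau_gen, False)"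

text \<open>
  With \<open>m = n - 2\<close>, the pair \<open>(c, k)\<close> stands for the edge in direction \<open>c\<close> at the vertex \<open>\<sigma>^k x\<close> of
  the block of \<open>x\<close>.
\<close>

definition exits :: "nat \<Rightarrow> ((gen2 \<times> bool) \<times> nat) set" where
  "exits m = {(c, k). k \<le> m \<and> (c = S \<longrightarrow> k = m) \<and> (c = S' \<longrightarrow> k = 0)}"

definition piece :: "(nat \<Rightarrow> gen2 \<times> bool) \<Rightarrow> (gen2 \<times> bool) \<times> nat \<Rightarrow> gen2 word set" where
  "piece s p = {x. reduced x \<and> toward s ((push S ^^ snd p) x) = fst p}"

text \<open>For \<open>n = m + 2\<close>, \<open>B_exit m i\<close> at \<open>x\<close> and
  \<open>A_exit i\<close> at the product of \<open>\<gamma> n i\<close> and \<open>x\<close> are the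
  same edge, read from its two ends.\<close>

definition A_exit :: "nat \<Rightarrow> (gen2 \<times> bool) \<times> nat" where
  "A_exit i = (if i = 0 then (S', 0) else (T', i - 1))"

definition B_exit :: "nat \<Rightarrow> nat \<Rightarrow> (gen2 \<times> bool) \<times> nat" where
  "B_exit m i = (if i = 0 then (S, m) else if i = 1 then (T, m) else (T, i - 2))"

lemma pieceD: "x \<in> piece s p \<Longrightarrow> reduced x"
  by (simp add: piece_def)

lemma reduced_funpow_push: "reduced x \<Longrightarrow> reduced ((push a ^^ k) x)"
  by (induction k) (auto intro: reduced_push)

lemma unique_piece:
  assumes s: "nonbacktracking s" and red: "reduced x"
  shows "\<exists>!p. p \<in> exits m \<and> x \<in> piece s p"
proof -
  let ?l = "\<lambda>k. toward s ((push S ^^ k) x)"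
  have "?l (Suc k) = S' \<longleftrightarrow> ?l k \<noteq> S" for k
    using toward_push[OF s reduced_funpow_push[OF red], where c = S] by (simp add: inv_letter_def)
  then have "\<exists>!k. k \<le> m \<and> (?l k = S \<longrightarrow> k = m) \<and> (?l k = S' \<longrightarrow> k = 0)"
    by (intro unique_exit) auto
  then obtain k where k: "k \<le> m" "?l k = S \<longrightarrow> k = m" "?l k = S' \<longrightarrow> k = 0"
    and u: "\<And>j. j \<le> m \<Longrightarrow> ?l j = S \<longrightarrow> j = m \<Longrightarrow> ?l j = S' \<longrightarrow> j = 0 \<Longrightarrow> j = k"
    by blast
  show ?thesis
  proof (rule ex1I[of _ "(?l k, k)"])
    show "(?l k, k) \<in> exits m \<and> x \<in> piece s (?l k, k)"
      using k red by (simp add: exits_def piece_def)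
    show "p = (?l k, k)" if "p \<in> exits m \<and> x \<in> piece s p" for p
      using that u[of "snd p"] by (cases p) (auto simp: exits_def piece_def)
  qed
qed

lemma letter_cases: "c = S \<or> c = S' \<or> c = T \<or> c = T'"
  by (cases c; cases "fst c"; cases "snd c") auto

text \<open>The \<open>T'\<close> edges take the nonzero indices of \<open>A_exit\<close>, the
  \<open>T\<close> edges those of \<open>B_exit m\<close>, where index 1 is the last vertex of the
  block.\<close>

lemma exits_eq:
  "exits m = A_exit ` {..<Suc (Suc m)} \<union> B_exit m ` {..<Suc (Suc m)}"
proof
  show "A_exit ` {..<Suc (Suc m)} \<union> B_exit m ` {..<Suc (Suc m)} \<subseteq> exits m"
    by (auto simp: exits_def A_exit_def B_exit_def)
  show "exits m \<subseteq> A_exit ` {..<Suc (Suc m)} \<union> B_exit m ` {..<Suc (Suc m)}"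
  proof
    fix p assume p: "p \<in> exits m"
    obtain c k where ck: "p = (c, k)" by (cases p)
    with p have k: "k \<le> m" by (simp add: exits_def)
    consider "c = S" "k = m" | "c = S'" "k = 0" | "c = T'" | "c = T" "k = m" | "c = T" "k < m"
      using letter_cases[of c] p ck k by (force simp: exits_def)
    then have "p = A_exit 0 \<or> p = A_exit (Suc k) \<or> p = B_exit m 0 \<or> p = B_exit m 1 \<or>
        k < m \<and> p = B_exit m (Suc (Suc k))"
      by cases (auto simp: ck A_exit_def B_exit_def)
    with k show "p \<in> A_exit ` {..<Suc (Suc m)} \<union> B_exit m ` {..<Suc (Suc m)}"
      by auto
  qed
qed

lemma card_exits: "card (exits m) = 2 * Suc (Suc m)"
proof -
  have "inj_on A_exit {..<Suc (Suc m)}" "inj_on (B_exit m) {..<Suc (Suc m)}"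
    by (auto simp: inj_on_def A_exit_def B_exit_def split: if_splits)
  moreover have "A_exit ` {..<Suc (Suc m)} \<inter> B_exit m ` {..<Suc (Suc m)} = {}"
    by (auto simp: A_exit_def B_exit_def split: if_splits)
  ultimately show ?thesis
    by (simp add: exits_eq card_Un_disjoint card_image)
qed

section \<open>Left multiplication by the elements \<open>\<gamma> n i\<close>\<close>

interpretation F2: group F2
  by (rule group_free_group)

lemma carrier_F2: "x \<in> carrier F2 \<longleftrightarrow> reduced x"
  by (simp add: free_group_def)

lemma free_gen_mult: "free_gen a \<otimes>\<^bsub>free_group\<^esub> x = push (a, True) x"
  by (simp add: free_group_def free_gen_def)

lemma sigma_closed [simp]: "\<sigma> \<in> carrier F2" and tau_closed [simp]: "\<tau> \<in> carrier F2"
  by (simp_all add: \<sigma>_def \<tau>_def free_gen_closed)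

lemma sigma_pow_mult:
  assumes "x \<in> carrier F2"
  shows "\<sigma> [^]\<^bsub>F2\<^esub> int k \<otimes>\<^bsub>F2\<^esub> x = (push S ^^ k) x"
proof -
  have "\<sigma> [^]\<^bsub>F2\<^esub> k \<otimes>\<^bsub>F2\<^esub> x = (push S ^^ k) x"
  proof (induction k)
    case (Suc k)
    have "\<sigma> [^]\<^bsub>F2\<^esub> Suc k \<otimes>\<^bsub>F2\<^esub> x = \<sigma> \<otimes>\<^bsub>F2\<^esub> (\<sigma> [^]\<^bsub>F2\<^esub> k \<otimes>\<^bsub>F2\<^esub> x)"
      using assms F2.nat_pow_Suc2[of \<sigma> k] by (simp add: F2.m_assoc del: F2.nat_pow_Suc)
    with Suc show ?case by (simp add: \<sigma>_def free_gen_mult)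
  qed (use assms in simp)
  then show ?thesis by (simp add: int_pow_int)
qed

lemma gamma_closed [simp]: "\<gamma> n i \<in> carrier F2"
  by (simp add: \<gamma>_def)

lemma sigma_pow_gamma:
  assumes x: "x \<in> carrier F2"
  shows "(push S ^^ snd (A_exit i)) (\<gamma> (Suc (Suc m)) i \<otimes>\<^bsub>F2\<^esub> x) =
    push (fst (B_exit m i)) ((push S ^^ snd (B_exit m i)) x)"
proof -
  consider "i = 0" | "i = 1" | "i \<ge> 2" by linarith
  then show ?thesis
  proof cases
    case 1
    have "\<gamma> (Suc (Suc m)) 0 \<otimes>\<^bsub>F2\<^esub> x = (push S ^^ Suc m) x"
      using sigma_pow_mult[OF x, of "Suc m"] by (simp add: \<gamma>_def)
    with 1 show ?thesis by (simp add: A_exit_def B_exit_def)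
  next
    case 2
    have "\<gamma> (Suc (Suc m)) 1 \<otimes>\<^bsub>F2\<^esub> x = push T ((push S ^^ m) x)"
      using sigma_pow_mult[OF x, of m] x
      by (simp add: \<gamma>_def F2.m_assoc) (simp add: \<tau>_def free_gen_mult)
    with 2 show ?thesis by (simp add: A_exit_def B_exit_def)
  next
    case 3
    then have "int i - 2 = int (i - 2)" by simp
    then have "\<gamma> (Suc (Suc m)) i \<otimes>\<^bsub>F2\<^esub> x =
        \<sigma> [^]\<^bsub>F2\<^esub> (- int i + 1) \<otimes>\<^bsub>F2\<^esub> push T ((push S ^^ (i - 2)) x)"
      using sigma_pow_mult[OF x, of "i - 2"] x 3
      by (simp add: \<gamma>_def F2.m_assoc) (simp add: \<tau>_def free_gen_mult)
    moreover have "(push S ^^ (i - 1)) (\<sigma> [^]\<^bsub>F2\<^esub> (- int i + 1) \<otimes>\<^bsub>F2\<^esub> y) = y"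
      if y: "y \<in> carrier F2" for y
    proof -
      have "int (i - 1) + (- int i + 1) = 0" using 3 by simp
      then have "\<sigma> [^]\<^bsub>F2\<^esub> int (i - 1) \<otimes>\<^bsub>F2\<^esub> \<sigma> [^]\<^bsub>F2\<^esub> (- int i + 1) = \<one>\<^bsub>F2\<^esub>"
        using F2.int_pow_mult[of \<sigma> "int (i - 1)" "- int i + 1"] by simp
      then have "\<sigma> [^]\<^bsub>F2\<^esub> int (i - 1) \<otimes>\<^bsub>F2\<^esub> (\<sigma> [^]\<^bsub>F2\<^esub> (- int i + 1) \<otimes>\<^bsub>F2\<^esub> y) = y"
        using y by (simp add: F2.m_assoc[symmetric])
      then show ?thesis using y by (simp add: sigma_pow_mult)
    qed
    ultimately show ?thesis
      using 3 x by (simp add: A_exit_def B_exit_def carrier_F2 reduced_push reduced_funpow_push)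
  qed
qed

text \<open>By \<open>sigma_pow_gamma\<close> the two labels describe one edge, which by
  \<open>toward_push\<close> is selected from exactly one end. Left multiplication is a bijection,
  so this becomes an equality of sets.\<close>

lemma gamma_piece:
  assumes s: "nonbacktracking s"
  shows "\<gamma> (Suc (Suc m)) i <#\<^bsub>F2\<^esub> piece s (B_exit m i) = carrier F2 - piece s (A_exit i)"
proof -
  let ?g = "\<gamma> (Suc (Suc m)) i"
  have key: "?g \<otimes>\<^bsub>F2\<^esub> x \<notin> piece s (A_exit i) \<longleftrightarrow> x \<in> piece s (B_exit m i)"
    if x: "x \<in> carrier F2" for x
  proof -
    have "reduced (?g \<otimes>\<^bsub>F2\<^esub> x)" using x by (simp flip: carrier_F2)
    moreover have "fst (A_exit i) = inv_letter (fst (B_exit m i))"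
      by (simp add: A_exit_def B_exit_def inv_letter_def)
    ultimately show ?thesis
      using x toward_push[OF s reduced_funpow_push, of x]
      by (simp add: piece_def sigma_pow_gamma[OF x] carrier_F2)
  qed
  show ?thesis
  proof (intro equalityI subsetI)
    fix y assume "y \<in> ?g <#\<^bsub>F2\<^esub> piece s (B_exit m i)"
    then obtain x where "x \<in> piece s (B_exit m i)" "y = ?g \<otimes>\<^bsub>F2\<^esub> x"
      by (auto simp: l_coset_def)
    moreover from this have "x \<in> carrier F2" by (simp add: piece_def carrier_F2)
    ultimately show "y \<in> carrier F2 - piece s (A_exit i)" using key by auto
  next
    fix y assume y: "y \<in> carrier F2 - piece s (A_exit i)"
    define x where "x = inv\<^bsub>F2\<^esub> ?g \<otimes>\<^bsub>F2\<^esub> y"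
    have x: "x \<in> carrier F2" "?g \<otimes>\<^bsub>F2\<^esub> x = y"
      using y by (auto simp: x_def F2.m_assoc[symmetric])
    then show "y \<in> ?g <#\<^bsub>F2\<^esub> piece s (B_exit m i)"
      using key[OF x(1)] y by (auto simp: l_coset_def)
  qed
qed

text \<open>If a piece is empty, its partner is everything, so that both pieces of another index are empty.\<close>

lemma piece_nonempty:
  assumes s: "nonbacktracking s" and p: "p \<in> exits m"
  shows "piece s p \<noteq> {}"
proof
  assume empty: "piece s p = {}"
  from p obtain i where i: "i < Suc (Suc m)" "p = A_exit i \<or> p = B_exit m i"
    by (auto simp: exits_eq)
  have full: "piece s q = carrier F2"
    if "q = A_exit i \<and> p = B_exit m i \<or> q = B_exit m i \<and> p = A_exit i" for q
    using that
  proof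
    assume "q = A_exit i \<and> p = B_exit m i"
    then show ?thesis
      using gamma_piece[OF s, of m i] empty by (auto simp: l_coset_def carrier_F2 dest: pieceD)
  next
    assume q: "q = B_exit m i \<and> p = A_exit i"
    show ?thesis
    proof (intro equalityI subsetI)
      fix x assume x: "x \<in> carrier F2"
      let ?g = "\<gamma> (Suc (Suc m)) i"
      have "?g \<otimes>\<^bsub>F2\<^esub> x \<in> ?g <#\<^bsub>F2\<^esub> piece s q"
        using gamma_piece[OF s, of m i] empty q x by auto
      then obtain x' where x': "x' \<in> piece s q" "?g \<otimes>\<^bsub>F2\<^esub> x = ?g \<otimes>\<^bsub>F2\<^esub> x'"
        by (auto simp: l_coset_def)
      moreover from this have "x' \<in> carrier F2" by (simp add: carrier_F2 pieceD)
      ultimately have "x = x'" using x by simp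
      with x' show "x \<in> piece s q" by simp
    qed (simp add: carrier_F2 pieceD)
  qed
  \<comment> \<open>There are at least two indices, so some \<open>j\<close> differs from
    \<open>i\<close>.\<close>
  define j :: nat where "j = (if i = 0 then 1 else 0)"
  have j: "j < Suc (Suc m)" "j \<noteq> i" by (auto simp: j_def)
  obtain q where q: "q \<in> exits m" "piece s q = carrier F2" "q \<noteq> A_exit j" "q \<noteq> B_exit m j"
  proof -
    have "A_exit i \<noteq> A_exit j" "A_exit i \<noteq> B_exit m j" "B_exit m i \<noteq> A_exit j"
      "B_exit m i \<noteq> B_exit m j"
      by (auto simp: A_exit_def B_exit_def j_def)
    moreover have "A_exit i \<in> exits m" "B_exit m i \<in> exits m"
      using i by (auto simp: exits_eq)
    ultimately show ?thesis using i(2) full that by metis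
  qed
  have "A_exit j \<in> exits m" "B_exit m j \<in> exits m"
    using j by (auto simp: exits_eq)
  moreover have "piece s r = {}" if "r \<in> exits m" "r \<noteq> q" for r
    using that q(1,2) unique_piece[OF s] pieceD by (metis carrier_F2 equals0I)
  ultimately have "piece s (A_exit j) = {}" "piece s (B_exit m j) = {}"
    using q(3,4) by auto
  then show False using gamma_piece[OF s, of m j] F2.one_closed by (auto simp: l_coset_def)
qed

text \<open>Disjoint nonempty pieces are distinct; this gives the partition exactly
  \<open>2 * n\<close> members.\<close>

lemma inj_on_piece:
  assumes s: "nonbacktracking s"
  shows "inj_on (piece s) (exits m)"
proof (rule inj_onI)
  fix p q assume pq: "p \<in> exits m" "q \<in> exits m" "piece s p = piece s q"
  obtain x where x: "x \<in> piece s p" using piece_nonempty[OF s pq(1)] by blast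
  then have "reduced x" by (simp add: piece_def)
  from unique_piece[OF s this, of m] x pq show "p = q" by metis
qed

lemma partition_on_pieces:
  assumes s: "nonbacktracking s"
  shows "partition_on (carrier F2) (piece s ` exits m)"
proof (rule partition_onI)
  show "\<Union> (piece s ` exits m) = carrier F2"
    using unique_piece[OF s] by (auto simp: carrier_F2 piece_def) blast
  show "disjnt X Y" if "X \<in> piece s ` exits m" "Y \<in> piece s ` exits m" "X \<noteq> Y" for X Y
  proof -
    obtain p q where pq: "p \<in> exits m" "q \<in> exits m" "X = piece s p" "Y = piece s q"
      using \<open>X \<in> _\<close> \<open>Y \<in> _\<close> by blast
    with \<open>X \<noteq> Y\<close> have "x \<notin> Y" if "x \<in> X" for x
      using that unique_piece[OF s pieceD, of x s p m] by blast
    then show ?thesis by (auto simp: disjnt_def)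
  qed
  show "{} \<notin> piece s ` exits m"
    using piece_nonempty[OF s] by (metis imageE)
qed

subsection \<open>Two points in the same piece\<close>

lemma funpow_push_ray:
  assumes "\<And>i. i < k \<Longrightarrow> s i = a"
  shows "(push a ^^ k) [] = ray s k"
  using assms
proof (induction k)
  case (Suc k)
  show ?case
  proof (cases k)
    case (Suc j)
    then show ?thesis using Suc.IH Suc.prems
      by (simp add: inv_letter_neq[symmetric] del: inv_letter_neq)
  qed (use Suc in simp)
qed simp

lemma funpow_push_cancel:
  "(push a ^^ k) (replicate k (inv_letter a) @ w) = w"
  by (induction k) (simp_all add: funpow_swap1)

lemma replicate_prefix_obtain:
  obtains k w where "xs = replicate k a @ w" "k \<le> m" "k = m \<or> w = [] \<or> hd w \<noteq> a"
proof (induction m arbitrary: xs thesis)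
  case 0
  then show ?case by force
next
  case (Suc m)
  show ?case
  proof (cases "xs \<noteq> [] \<and> hd xs = a")
    case True
    then obtain ys where xs: "xs = a # ys" by (cases xs) auto
    obtain k w where "ys = replicate k a @ w" "k \<le> m" "k = m \<or> w = [] \<or> hd w \<noteq> a"
      by (rule Suc.IH)
    then show ?thesis
      by (intro Suc.prems[of "Suc k" w]) (auto simp: xs)
  qed (use Suc.prems[of 0 xs] in auto)
qed

lemma same_piece:
  assumes red: "reduced \<omega>"
  shows "\<exists>s. nonbacktracking s \<and>
    (\<exists>p\<in>exits m. [] \<in> piece s p \<and> \<omega> \<in> piece s p)"
proof -
  \<comment> \<open>Cancelling leading letters \<open>S'\<close> moves along the block of \<omega>
    towards \<epsilon>; \<open>w\<close> is the vertex of the block nearest to \<epsilon>.\<close>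
  obtain k w where \<omega>: "\<omega> = replicate k S' @ w" and "k \<le> m"
    and max: "k = m \<or> w = [] \<or> hd w \<noteq> S'"
    by (rule replicate_prefix_obtain)
  have w: "(push S ^^ k) \<omega> = w"
    using funpow_push_cancel[of k S w] by (simp add: \<omega> inv_letter_def)
  show ?thesis
  proof (cases "w = []")
    case True
    \<comment> \<open>Here the block of \<omega> contains \<epsilon>, and the end with all steps
      \<open>S\<close> leaves both blocks at their last vertex.\<close>
    define s :: "nat \<Rightarrow> gen2 \<times> bool" where "s = (\<lambda>_. S)"
    have pow: "(push S ^^ i) [] = ray s i" for i
      by (rule funpow_push_ray) (simp add: s_def)
    have "(push S ^^ m) \<omega> = (push S ^^ (m - k)) ((push S ^^ k) \<omega>)"
      using \<open>k \<le> m\<close> by (simp flip: funpow_add[THEN fun_cong, unfolded comp_def])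
    then have "[] \<in> piece s (S, m) \<and> \<omega> \<in> piece s (S, m)"
      using red by (simp add: piece_def w True pow) (simp add: s_def)
    moreover have "(S, m) \<in> exits m" by (simp add: exits_def)
    ultimately show ?thesis
      by (intro exI[of _ s] conjI bexI[of _ "(S, m)"]) (simp_all add: nonbacktracking_def s_def inv_letter_def)
  next
    case False
    define c where "c = inv_letter (hd w)"
    \<comment> \<open>the end \<open>c^\<infinity> \<sigma>^k\<close>, where \<open>c\<close> leads from \<open>\<sigma>^k \<omega>\<close> towards \<open>\<epsilon>\<close>\<close>
    define s where "s = (\<lambda>i. if i < k then S else c)"
    \<comment> \<open>In the reduced word \<omega>, \<open>S'\<close> is not followed by
      \<open>S\<close>. Hence \<open>c\<close> is not \<open>S'\<close>, and the ray does not turn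
      back at index \<open>k\<close>.\<close>
    have hd_w: "hd w \<noteq> S" if k: "k \<noteq> 0"
    proof -
      obtain j where j: "k = Suc j" using k by (cases k) auto
      have "\<omega> = replicate j S' @ S' # w" by (simp add: \<omega> j replicate_append_same[symmetric])
      with red False show ?thesis
        by (auto simp: reduced_def successively_append_iff successively_Cons inv_letter_def)
    qed
    have pow: "(push S ^^ k) [] = ray s k"
      by (rule funpow_push_ray) (simp add: s_def)
    have valid: "s (Suc i) \<noteq> inv_letter (s i)" for i
    proof (cases "i < k \<and> \<not> Suc i < k")
      case True
      then show ?thesis using hd_w
        by (auto simp: s_def c_def inv_letter_eq_iff)
    qed (auto simp: s_def inv_letter_neq[symmetric] simp del: inv_letter_neq)
    \<comment> \<open>A nonempty word on the ray begins with \<open>c\<close>, or with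
      \<open>S\<close> if \<open>k\<close> is nonzero; \<open>w\<close> begins with neither.\<close>
    have off_ray: "w \<noteq> ray s (length w)"
    proof
      assume eq: "w = ray s (length w)"
      obtain j where "length w = Suc j" using False by (cases w) auto
      with eq have "hd w = s j" by (metis list.sel(1) ray_Suc)
      moreover have "hd w \<noteq> c" unfolding c_def by (metis inv_letter_neq)
      ultimately show False using hd_w by (auto simp: s_def split: if_splits)
    qed
    then have "toward s w = c" by (simp add: toward_def c_def)
    then have "[] \<in> piece s (c, k) \<and> \<omega> \<in> piece s (c, k)"
      using red by (simp add: piece_def w pow) (simp add: s_def)
    moreover have "(c, k) \<in> exits m"
      using \<open>k \<le> m\<close> max hd_w False
      by (auto simp: exits_def c_def inv_letter_eq_iff) (auto simp: inv_letter_def)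
    ultimately show ?thesis using valid by (auto simp: nonbacktracking_def)
  qed
qed

theorem theorem2p5:
  fixes n :: nat and \<omega> :: "gen2 word"
  assumes "n \<ge> 2" and "\<omega> \<in> carrier F2"
  shows "\<exists>(A :: nat \<Rightarrow> gen2 word set) (B :: nat \<Rightarrow> gen2 word set) P.
    P = A ` {..<n} \<union> B ` {..<n} \<and>
    card P = 2 * n \<and>
    partition_on (carrier F2) P \<and>
    (\<exists>X\<in>P. \<one>\<^bsub>F2\<^esub> \<in> X \<and> \<omega> \<in> X) \<and>
    (\<forall>i<n. \<gamma> n i <#\<^bsub>F2\<^esub> B i = carrier F2 - A i)"
proof -
  obtain m where n: "n = Suc (Suc m)"
    using assms(1) by (metis add_2_eq_Suc le_Suc_ex)
  obtain s p where s: "nonbacktracking s"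
    and p: "p \<in> exits m" "[] \<in> piece s p" "\<omega> \<in> piece s p"
    using same_piece[of \<omega> m] assms(2) by (auto simp: carrier_F2)
  let ?A = "\<lambda>i. piece s (A_exit i)" and ?B = "\<lambda>i. piece s (B_exit m i)"
  have P: "piece s ` exits m = ?A ` {..<n} \<union> ?B ` {..<n}"
    by (simp only: exits_eq n image_Un image_image)
  have "card (piece s ` exits m) = 2 * n"
    using card_image[OF inj_on_piece[OF s]] by (simp add: card_exits n)
  moreover have "\<exists>X\<in>piece s ` exits m. \<one>\<^bsub>F2\<^esub> \<in> X \<and> \<omega> \<in> X"
    using p by (auto simp add: free_group_def)
  moreover have "\<forall>i<n. \<gamma> n i <#\<^bsub>F2\<^esub> ?B i = carrier F2 - ?A i"
    using gamma_piece[OF s] by (simp add: n)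
  ultimately have "piece s ` exits m = ?A ` {..<n} \<union> ?B ` {..<n} \<and>
    card (piece s ` exits m) = 2 * n \<and>
    partition_on (carrier F2) (piece s ` exits m) \<and>
    (\<exists>X\<in>piece s ` exits m. \<one>\<^bsub>F2\<^esub> \<in> X \<and> \<omega> \<in> X) \<and>
    (\<forall>i<n. \<gamma> n i <#\<^bsub>F2\<^esub> ?B i = carrier F2 - ?A i)"
    using P partition_on_pieces[OF s, of m] by blast
  then show ?thesis
    by - (rule exI[of _ ?A], rule exI[of _ ?B], rule exI[of _ "piece s ` exits m"])
qed

end
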